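(* There exists an inverse system of abelian groups $\cdots \to A_{i+1} \to A_i \to \cdots \to A_1$ indexed by $\mathbb{N}$ such that all the maps $A_{i+1} \to A_i$ are epimorphisms and the kernel of the natural map $H_2(\varprojlim A_i) \to \varprojlim H_2(A_i)$ is not a cotorsion group.
   Context: $H_n(G) = H_n(G,\mathbb{Z})$ denotes the $n$-th group homology with integer coefficients. An abelian group $A$ is called a cotorsion group if $A \cong {\varprojlim}^1 B_i$ for some tower (inverse system indexed by $\mathbb{N}$) of abelian groups $B_i$; equivalently, if $\mathrm{Ext}(C,A)=0$ for every torsion-free abelian group $C$. *)

theory Defs
  imports "HOL-Algebra.Free_Abelian_Groups"
begin

section \<open>Group homology with integer coefficients\<close>

text \<open>
  Homology of the unnormalised inhomogeneous bar complex (the bar resolution tensored with the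
  trivial module). The basis element $[g_1|\dots|g_n]$ in degree $n$ is the list of its entries,
  and the boundary of $[g_1|\dots|g_n]$ is the alternating sum of its faces
  $[g_2|\dots|g_n]$, $[g_1|\dots|g_i g_{i+1}|\dots|g_n]$ for $0 < i < n$, and
  $[g_1|\dots|g_{n-1}]$.
\<close>

definition bar_chain_group :: "nat \<Rightarrow> ('a, 'm) monoid_scheme \<Rightarrow> ('a list \<Rightarrow>\<^sub>0 int) monoid"
  where "bar_chain_group n G = free_Abelian_group {xs. length xs = n \<and> set xs \<subseteq> carrier G}"

definition bar_face :: "('a, 'm) monoid_scheme \<Rightarrow> nat \<Rightarrow> 'a list \<Rightarrow> 'a list"
  where "bar_face G i xs =
    (if i = 0 then tl xs
     else if i = length xs then butlast xs
     else take (i - 1) xs @ [xs ! (i - 1) \<otimes>\<^bsub>G\<^esub> xs ! i] @ drop (i + 1) xs)"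

definition bar_boundary ::
    "('a, 'm) monoid_scheme \<Rightarrow> ('a list \<Rightarrow>\<^sub>0 int) \<Rightarrow> ('a list \<Rightarrow>\<^sub>0 int)"
  where "bar_boundary G = frag_extend (\<lambda>xs.
    if xs = [] then 0
    else (\<Sum>i\<le>length xs. frag_cmul ((-1) ^ i) (frag_of (bar_face G i xs))))"

definition bar_cycles :: "nat \<Rightarrow> ('a, 'm) monoid_scheme \<Rightarrow> ('a list \<Rightarrow>\<^sub>0 int) set"
  where "bar_cycles n G = {c \<in> carrier (bar_chain_group n G). bar_boundary G c = 0}"

definition bar_boundaries :: "nat \<Rightarrow> ('a, 'm) monoid_scheme \<Rightarrow> ('a list \<Rightarrow>\<^sub>0 int) set"
  where "bar_boundaries n G = bar_boundary G ` carrier (bar_chain_group (Suc n) G)"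

definition group_homology :: "nat \<Rightarrow> ('a, 'm) monoid_scheme \<Rightarrow> ('a list \<Rightarrow>\<^sub>0 int) set monoid"
  where "group_homology n G =
    (bar_chain_group n G)\<lparr>carrier := bar_cycles n G\<rparr> Mod bar_boundaries n G"

text \<open>
  The induced map sends the class of \<open>c\<close> to the class of \<open>f\<^sub># c\<close>; the image below is a singleton
  whenever \<open>f\<close> is a homomorphism from \<open>G\<close> to \<open>H\<close> and \<open>u\<close> is a homology class of \<open>G\<close>.
\<close>

definition group_homology_map ::
    "nat \<Rightarrow> ('b, 'n) monoid_scheme \<Rightarrow> ('a \<Rightarrow> 'b)
      \<Rightarrow> ('a list \<Rightarrow>\<^sub>0 int) set \<Rightarrow> ('b list \<Rightarrow>\<^sub>0 int) set"
  where "group_homology_map n H f u =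
    the_elem ((\<lambda>c. bar_boundaries n H #>\<^bsub>bar_chain_group n H\<^esub> frag_extend (frag_of \<circ> map f) c) ` u)"


section \<open>Towers of abelian groups\<close>

definition abelian_tower :: "(nat \<Rightarrow> ('a, 'm) monoid_scheme) \<Rightarrow> (nat \<Rightarrow> 'a \<Rightarrow> 'a) \<Rightarrow> bool"
  where "abelian_tower A f \<longleftrightarrow> (\<forall>i. comm_group (A i)) \<and> (\<forall>i. f i \<in> hom (A (Suc i)) (A i))"

definition tower_lim ::
    "(nat \<Rightarrow> ('a, 'm) monoid_scheme) \<Rightarrow> (nat \<Rightarrow> 'a \<Rightarrow> 'a) \<Rightarrow> (nat \<Rightarrow> 'a) monoid"
  where "tower_lim A f = (product_group UNIV A)
    \<lparr>carrier := {x \<in> carrier (product_group UNIV A). \<forall>i. f i (x (Suc i)) = x i}\<rparr>"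

definition homology_lim_map ::
    "nat \<Rightarrow> (nat \<Rightarrow> ('a, 'm) monoid_scheme)
      \<Rightarrow> ((nat \<Rightarrow> 'a) list \<Rightarrow>\<^sub>0 int) set \<Rightarrow> nat \<Rightarrow> ('a list \<Rightarrow>\<^sub>0 int) set"
  where "homology_lim_map n A u = (\<lambda>i. group_homology_map n (A i) (\<lambda>x. x i) u)"

definition tower_shift ::
    "(nat \<Rightarrow> ('a, 'm) monoid_scheme) \<Rightarrow> (nat \<Rightarrow> 'a \<Rightarrow> 'a) \<Rightarrow> (nat \<Rightarrow> 'a) \<Rightarrow> nat \<Rightarrow> 'a"
  where "tower_shift A f x = (\<lambda>i. x i \<otimes>\<^bsub>A i\<^esub> inv\<^bsub>A i\<^esub> (f i (x (Suc i))))"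

definition tower_lim1 ::
    "(nat \<Rightarrow> ('a, 'm) monoid_scheme) \<Rightarrow> (nat \<Rightarrow> 'a \<Rightarrow> 'a) \<Rightarrow> (nat \<Rightarrow> 'a) set monoid"
  where "tower_lim1 A f =
    product_group UNIV A Mod (tower_shift A f ` carrier (product_group UNIV A))"

text \<open>
  A definition cannot quantify over the type carrying the tower. The type chosen here is large
  enough: by \<open>cotorsion_group_if_iso_tower_lim1\<close> below, an abelian group that is isomorphic to
  $\varprojlim^1$ of a tower carried by any type whatsoever satisfies this definition.
\<close>

definition cotorsion_group :: "('a, 'm) monoid_scheme \<Rightarrow> bool"
  where "cotorsion_group K \<longleftrightarrow>
    (\<exists>(B :: nat \<Rightarrow> (nat \<Rightarrow> 'a \<Rightarrow>\<^sub>0 int) monoid) g. abelian_tower B g \<and> K \<cong> tower_lim1 B g)"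


section \<open>Independence of the type carrying the tower\<close>

lemma comm_group_product_group:
  assumes "\<And>i. i \<in> I \<Longrightarrow> comm_group (G i)"
  shows "comm_group (product_group I G)"
proof (rule group.group_comm_groupI)
  show "group (product_group I G)"
    using assms by (simp add: comm_group.axioms(2))
  fix x y assume "x \<in> carrier (product_group I G)" "y \<in> carrier (product_group I G)"
  then show "x \<otimes>\<^bsub>product_group I G\<^esub> y = y \<otimes>\<^bsub>product_group I G\<^esub> x"
    using assms by (auto simp: PiE_iff comm_group_def intro!: restrict_ext comm_monoid.m_comm)
qed

lemma tower_shift_hom:
  assumes "abelian_tower B g"
  shows "tower_shift B g \<in> hom (product_group UNIV B) (product_group UNIV B)"
proof (rule homI)
  have cg: "comm_group (B i)" and gh: "g i \<in> hom (B (Suc i)) (B i)" for i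
    using assms by (auto simp: abelian_tower_def)
  have gr: "group (B i)" for i
    using cg by (simp add: comm_group.axioms(2))
  have ghom: "group_hom (B (Suc i)) (B i) (g i)" for i
    using gr gh by (simp add: group_hom_def group_hom_axioms_def)
  fix x assume x: "x \<in> carrier (product_group UNIV B)"
  then have xi: "x i \<in> carrier (B i)" for i by auto
  show "tower_shift B g x \<in> carrier (product_group UNIV B)"
    using xi hom_in_carrier[OF gh] gr
    by (auto simp: tower_shift_def group.is_monoid intro!: monoid.m_closed group.inv_closed)
  fix y assume y: "y \<in> carrier (product_group UNIV B)"
  then have yi: "y i \<in> carrier (B i)" for i by auto
  show "tower_shift B g (x \<otimes>\<^bsub>product_group UNIV B\<^esub> y) =
      tower_shift B g x \<otimes>\<^bsub>product_group UNIV B\<^esub> tower_shift B g y"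
  proof
    fix i
    interpret comm_group "B i" by (rule cg)
    have c: "g i (x (Suc i)) \<in> carrier (B i)" "g i (y (Suc i)) \<in> carrier (B i)"
      using xi yi hom_in_carrier[OF gh] by auto
    have "g i (x (Suc i) \<otimes>\<^bsub>B (Suc i)\<^esub> y (Suc i)) = g i (x (Suc i)) \<otimes>\<^bsub>B i\<^esub> g i (y (Suc i))"
      using hom_mult[OF gh] xi yi by blast
    then show "tower_shift B g (x \<otimes>\<^bsub>product_group UNIV B\<^esub> y) i =
      (tower_shift B g x \<otimes>\<^bsub>product_group UNIV B\<^esub> tower_shift B g y) i"
      using c xi[of i] yi[of i] by (simp add: tower_shift_def inv_mult m_ac)
  qed
qed

lemma tower_shift_subgroup:
  assumes "abelian_tower B g"
  shows "subgroup (tower_shift B g ` carrier (product_group UNIV B)) (product_group UNIV B)"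
proof -
  have "group (product_group UNIV B)"
    using assms by (simp add: abelian_tower_def comm_group.axioms(2))
  then interpret group_hom "product_group UNIV B" "product_group UNIV B" "tower_shift B g"
    using tower_shift_hom[OF assms] by (simp add: group_hom_def group_hom_axioms_def)
  show ?thesis by (rule img_is_subgroup)
qed

lemma single_in_tower_shift:
  assumes "abelian_tower B g" "c \<in> carrier (B i)"
  shows "(\<lambda>j. if j = i then c else \<one>\<^bsub>B j\<^esub>) \<in> tower_shift B g ` carrier (product_group UNIV B)"
  using assms(2)
proof (induction i arbitrary: c)
  have cg: "comm_group (B i)" and gh: "g i \<in> hom (B (Suc i)) (B i)" for i
    using assms(1) by (auto simp: abelian_tower_def)
  have gr: "group (B i)" for i
    using cg by (simp add: comm_group.axioms(2))
  have g1: "g i \<one>\<^bsub>B (Suc i)\<^esub> = \<one>\<^bsub>B i\<^esub>" for i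
    using hom_one[OF gh gr gr] .
  have i1: "inv\<^bsub>B i\<^esub> \<one>\<^bsub>B i\<^esub> = \<one>\<^bsub>B i\<^esub>" and c1: "\<one>\<^bsub>B i\<^esub> \<in> carrier (B i)" for i
    using gr[of i] by (simp_all add: group.is_monoid monoid.inv_one)
  have l1: "\<one>\<^bsub>B i\<^esub> \<otimes>\<^bsub>B i\<^esub> c = c" "c \<otimes>\<^bsub>B i\<^esub> \<one>\<^bsub>B i\<^esub> = c" "inv\<^bsub>B i\<^esub> c \<otimes>\<^bsub>B i\<^esub> c = \<one>\<^bsub>B i\<^esub>"
      "inv\<^bsub>B i\<^esub> c \<in> carrier (B i)"
    if "c \<in> carrier (B i)" for i c
    using gr[of i] that by (simp_all add: group.is_monoid group.l_inv)
  have e: "(\<lambda>j. if j = i then c else \<one>\<^bsub>B j\<^esub>) \<in> carrier (product_group UNIV B)"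
    if "c \<in> carrier (B i)" for c i
    using that c1 by auto
  {
    case 0
    have "tower_shift B g (\<lambda>j. if j = 0 then c else \<one>\<^bsub>B j\<^esub>) = (\<lambda>j. if j = 0 then c else \<one>\<^bsub>B j\<^esub>)"
      using 0 by (auto simp: tower_shift_def g1 i1 l1 c1)
    then show ?case using imageI[OF e[OF 0], of "tower_shift B g"] by simp
  next
    case (Suc i)
    let ?P = "product_group UNIV B"
    let ?e = "\<lambda>i c. (\<lambda>j. if j = i then c else \<one>\<^bsub>B j\<^esub>)"
    have gc: "g i c \<in> carrier (B i)" using Suc.prems hom_in_carrier[OF gh] by blast
    have "tower_shift B g (?e (Suc i) c) \<otimes>\<^bsub>?P\<^esub> ?e i (g i c) = ?e (Suc i) c"
    proof
      fix j
      show "(tower_shift B g (?e (Suc i) c) \<otimes>\<^bsub>?P\<^esub> ?e i (g i c)) j = ?e (Suc i) c j"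
        using gc Suc.prems by (auto simp: tower_shift_def g1 i1 l1 c1)
    qed
    moreover have "tower_shift B g (?e (Suc i) c) \<otimes>\<^bsub>?P\<^esub> ?e i (g i c)
        \<in> tower_shift B g ` carrier ?P"
      using subgroup.m_closed[OF tower_shift_subgroup[OF assms(1)]] Suc.IH[OF gc]
        e[OF Suc.prems] by blast
    ultimately show ?case by (simp only:)
  }
qed

lemma cotorsion_group_if_epi:
  fixes K :: "('a, 'm) monoid_scheme" and \<psi> :: "(nat \<Rightarrow> 'a \<Rightarrow>\<^sub>0 int) \<Rightarrow> 'a"
  assumes K: "comm_group K"
    and \<psi>: "\<psi> \<in> epi (product_group UNIV (\<lambda>_. free_Abelian_group S)) K"
    and single: "\<And>i c. c \<in> carrier (free_Abelian_group S) \<Longrightarrow> \<psi> (\<lambda>j. if j = i then c else 0) = \<one>\<^bsub>K\<^esub>"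
  shows "cotorsion_group K"
proof -
  define F where "F = free_Abelian_group S"
  define P where "P = product_group (UNIV :: nat set) (\<lambda>_. F)"
  interpret F: comm_group F unfolding F_def by (rule abelian_free_Abelian_group)
  interpret P: comm_group P
    unfolding P_def by (rule comm_group_product_group) (rule F.comm_group_axioms)
  interpret K: comm_group K by (rule K)
  have \<psi>hom: "\<psi> \<in> hom P K" and \<psi>onto: "\<psi> ` carrier P = carrier K"
    using \<psi> by (auto simp: P_def F_def epi_def)
  interpret \<psi>: group_hom P K \<psi>
    by unfold_locales (rule \<psi>hom)
  have Pc: "x \<in> carrier P \<longleftrightarrow> (\<forall>i. x i \<in> carrier F)" for x
    by (auto simp: P_def)
  have Pm: "x \<otimes>\<^bsub>P\<^esub> y = (\<lambda>i. x i + y i)" for x y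
    by (auto simp: P_def F_def)
  have P1: "\<one>\<^bsub>P\<^esub> = (\<lambda>i. 0)"
    by (auto simp: P_def F_def)
  have Fadd: "a + b \<in> carrier F" if "a \<in> carrier F" "b \<in> carrier F" for a b
    using F.m_closed[OF that] by (simp add: F_def)
  have Fneg: "- a \<in> carrier F" if "a \<in> carrier F" for a
    using that by (simp add: F_def)
  have F0: "0 \<in> carrier F" by (simp add: F_def)
  have Fsum: "finite I \<Longrightarrow> (\<And>i. i \<in> I \<Longrightarrow> h i \<in> carrier F) \<Longrightarrow> sum h I \<in> carrier F" for h and I :: "nat set"
    by (induction I rule: finite_induct) (auto simp: Fadd F0 simp del: carrier_free_Abelian_group_iff)
  have Pi: "inv\<^bsub>P\<^esub> x = (\<lambda>i. - x i)" if "x \<in> carrier P" for x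
    by (rule P.inv_equality) (use that Fneg in \<open>auto simp: Pc Pm P1\<close>)
  define N where "N i = {x \<in> carrier P. \<psi> x = \<one>\<^bsub>K\<^esub> \<and> (\<forall>j<i. x j = 0)}" for i :: nat
  have Pm': "(x \<otimes>\<^bsub>P\<^esub> y) i = x i + y i" for x y i by (simp add: Pm)
  have P1': "\<one>\<^bsub>P\<^esub> i = 0" for i by (simp add: P1)
  have Pi': "(inv\<^bsub>P\<^esub> x) i = - x i" if "x \<in> carrier P" for x i by (simp add: Pi that)
  have Nsub: "subgroup (N i) P" for i
    by (rule subgroup.intro) (auto simp: N_def Pm' P1' Pi')
  have N0: "x \<in> N 0" if "x \<in> N i" for x i
    using that by (auto simp: N_def)
  define B where "B i = P\<lparr>carrier := N i\<rparr>" for i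
  define g where "g = (\<lambda>(i::nat) (x :: nat \<Rightarrow> 'a \<Rightarrow>\<^sub>0 int). x)"
  have Bc: "carrier (B i) = N i" and Bm: "x \<otimes>\<^bsub>B i\<^esub> y = x \<otimes>\<^bsub>P\<^esub> y" and B1: "\<one>\<^bsub>B i\<^esub> = \<one>\<^bsub>P\<^esub>" for i x y
    by (auto simp: B_def)
  have Binv: "inv\<^bsub>B i\<^esub> x = inv\<^bsub>P\<^esub> x" if "x \<in> N i" for x i
    unfolding B_def using P.m_inv_consistent[OF Nsub that] .
  have cB: "comm_group (B i)" for i
    proof (rule group.group_comm_groupI)
    show "group (B i)"
      unfolding B_def by (rule subgroup.subgroup_is_group[OF Nsub P.group_axioms])
    show "x \<otimes>\<^bsub>B i\<^esub> y = y \<otimes>\<^bsub>B i\<^esub> x" for x y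
      by (simp add: Bm Pm add.commute)
  qed
  have tower: "abelian_tower B g"
    using cB by (auto simp: abelian_tower_def g_def hom_def Bc Bm N_def)
  define Q where "Q = product_group UNIV B"
  interpret Q: comm_group Q
    unfolding Q_def by (rule comm_group_product_group) (rule cB)
  have Qc: "y \<in> carrier Q \<longleftrightarrow> (\<forall>i. y i \<in> N i)" for y
    by (auto simp: Q_def Bc)
  have Qm: "(y \<otimes>\<^bsub>Q\<^esub> z) i = y i \<otimes>\<^bsub>P\<^esub> z i" for y z i
    by (simp add: Q_def Bm)
  define s where "s y = (\<lambda>j. \<Sum>i\<le>j. y i j)" for y :: "nat \<Rightarrow> nat \<Rightarrow> 'a \<Rightarrow>\<^sub>0 int"
  have NF: "y i j \<in> carrier F" if "y \<in> carrier Q" for y i j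
    using that by (auto simp: Qc N_def Pc)
  have sP: "s y \<in> carrier P" if "y \<in> carrier Q" for y
    using NF[OF that] by (auto simp: Pc s_def intro!: Fsum)
  have s_mult: "s (y \<otimes>\<^bsub>Q\<^esub> z) = s y \<otimes>\<^bsub>P\<^esub> s z" for y z
    by (rule ext) (simp add: s_def Qm Pm' sum.distrib)
  define \<Theta> where "\<Theta> y = \<psi> (s y)" for y
  have \<Theta>hom: "\<Theta> \<in> hom Q K"
    by (rule homI) (auto simp: \<Theta>_def sP s_mult)
  interpret \<Theta>: group_hom Q K \<Theta>
    by unfold_locales (rule \<Theta>hom)
  have onto: "\<Theta> ` carrier Q = carrier K"
  proof
    show "\<Theta> ` carrier Q \<subseteq> carrier K" by auto
    show "carrier K \<subseteq> \<Theta> ` carrier Q"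
    proof
      fix a assume "a \<in> carrier K"
      then obtain p where p: "p \<in> carrier P" "a = \<psi> p" using \<psi>onto by blast
      define y where "y i = (\<lambda>j. if j = i then p i else 0)" for i :: nat
      have "y i \<in> N i" for i
        using p(1) single[of "p i" i] F0 by (auto simp: N_def y_def Pc F_def)
      then have "y \<in> carrier Q" by (simp add: Qc)
      moreover have "s y = p" by (rule ext) (simp add: s_def y_def)
      ultimately show "a \<in> \<Theta> ` carrier Q" using p(2) by (auto simp: \<Theta>_def)
    qed
  qed
  have shift: "tower_shift B g x i j = x i j - x (Suc i) j" if "x \<in> carrier Q" for x i j
  proof -
    have "x (Suc i) \<in> N (Suc i)" using that by (simp add: Qc)
    then have xs: "x (Suc i) \<in> N i" "x (Suc i) \<in> carrier P" by (auto simp: N_def)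
    then show ?thesis by (simp add: tower_shift_def g_def Bm Binv Pm' Pi')
  qed
  have ker: "kernel Q K \<Theta> = tower_shift B g ` carrier Q"
  proof
    show "tower_shift B g ` carrier Q \<subseteq> kernel Q K \<Theta>"
    proof (rule image_subsetI)
      fix x assume x: "x \<in> carrier Q"
      have "s (tower_shift B g x) = x 0"
      proof
        fix j
        have "s (tower_shift B g x) j = (\<Sum>i\<le>j. x i j - x (Suc i) j)"
          by (simp add: s_def shift[OF x])
        also have "\<dots> = x 0 j - x (Suc j) j"
          by (rule sum_telescope)
        also have "x (Suc j) j = 0" using x by (auto simp: Qc N_def)
        finally show "s (tower_shift B g x) j = x 0 j" by simp
      qed
      moreover have "\<psi> (x 0) = \<one>\<^bsub>K\<^esub>" using x by (auto simp: Qc N_def)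
      moreover have "tower_shift B g x \<in> carrier Q"
        using tower_shift_hom[OF tower] x unfolding Q_def[symmetric] by (rule hom_in_carrier)
      ultimately show "tower_shift B g x \<in> kernel Q K \<Theta>"
        by (simp add: kernel_def \<Theta>_def)
    qed
    show "kernel Q K \<Theta> \<subseteq> tower_shift B g ` carrier Q"
    proof
      fix y assume "y \<in> kernel Q K \<Theta>"
      then have y: "y \<in> carrier Q" and sy: "\<psi> (s y) = \<one>\<^bsub>K\<^esub>"
        by (auto simp: kernel_def \<Theta>_def)
      define x where "x i = (\<lambda>j. \<Sum>m\<in>{i..j}. y m j)" for i :: nat
      have yz: "y i j = 0" if "j < i" for i j using y that by (auto simp: Qc N_def)
      have step: "x i = x (Suc i) \<otimes>\<^bsub>P\<^esub> y i" for i
      proof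
        fix j show "x i j = (x (Suc i) \<otimes>\<^bsub>P\<^esub> y i) j"
          by (cases "i \<le> j") (simp_all add: x_def Pm' yz sum.atLeast_Suc_atMost)
      qed
      have xP: "x i \<in> carrier P" for i
        using NF[OF y] by (auto simp: Pc x_def intro!: Fsum)
      have yP: "y i \<in> carrier P" "\<psi> (y i) = \<one>\<^bsub>K\<^esub>" for i using y by (auto simp: Qc N_def)
      have "\<psi> (x i) = \<one>\<^bsub>K\<^esub>" for i
      proof (induction i)
        case 0
        have "x 0 = s y" by (rule ext) (simp add: x_def s_def atMost_atLeast0)
        then show ?case using sy by simp
      next
        case (Suc i)
        have "\<psi> (x i) = \<psi> (x (Suc i)) \<otimes>\<^bsub>K\<^esub> \<psi> (y i)"
          unfolding step[of i] by (rule \<psi>.hom_mult[OF xP yP(1)])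
        then show ?case using Suc yP(2) xP by simp
      qed
      then have xQ: "x \<in> carrier Q"
        using xP by (auto simp: Qc N_def) (simp add: x_def)
      have "tower_shift B g x = y"
      proof (intro ext)
        fix i j
        have "x i j = x (Suc i) j + y i j" using fun_cong[OF step[of i], of j] by (simp only: Pm')
        then show "tower_shift B g x i j = y i j" using shift[OF xQ] by simp
      qed
      then show "y \<in> tower_shift B g ` carrier Q" using xQ by blast
    qed
  qed
  have L: "tower_lim1 B g = Q Mod kernel Q K \<Theta>"
    unfolding ker by (simp only: tower_lim1_def Q_def)
  have "tower_lim1 B g \<cong> K"
    unfolding L by (rule \<Theta>.FactGroup_iso[OF onto])
  moreover have "group (tower_lim1 B g)"
    unfolding L by (rule normal.factorgroup_is_group[OF \<Theta>.normal_kernel])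
  ultimately have "K \<cong> tower_lim1 B g"
    using group.iso_sym by blast
  then show ?thesis unfolding cotorsion_group_def using tower by blast
qed

lemma cotorsion_group_if_iso_tower_lim1:
  fixes K :: "('a, 'm) monoid_scheme" and B :: "nat \<Rightarrow> ('b, 'n) monoid_scheme"
  assumes K: "comm_group K" and tower: "abelian_tower B g" and iso: "K \<cong> tower_lim1 B g"
  shows "cotorsion_group K"
proof -
  define Q where "Q = product_group UNIV B"
  define D where "D = tower_shift B g ` carrier Q"
  define F where "F = free_Abelian_group (carrier K)"
  define P where "P = product_group (UNIV :: nat set) (\<lambda>_. F)"
  interpret K: comm_group K by (rule K)
  interpret F: comm_group F unfolding F_def by (rule abelian_free_Abelian_group)
  interpret Q: comm_group Q
    unfolding Q_def by (rule comm_group_product_group) (use tower in \<open>simp add: abelian_tower_def\<close>)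
  have Dsub: "subgroup D Q"
    unfolding D_def Q_def by (rule tower_shift_subgroup[OF tower])
  then have Dn: "D \<lhd> Q" by (simp add: Q.normal_iff_subgroup)
  have L: "tower_lim1 B g = Q Mod D" by (simp add: tower_lim1_def D_def Q_def)
  obtain h where h: "h \<in> iso (Q Mod D) K"
    using K.iso_sym[OF iso] unfolding L is_iso_def by blast
  define \<pi> where "\<pi> x = h (D #>\<^bsub>Q\<^esub> x)" for x
  have \<pi>hom: "\<pi> \<in> hom Q K"
    unfolding \<pi>_def using hom_compose[OF normal.r_coset_hom_Mod[OF Dn], of h K] h
    by (simp add: iso_def o_def)
  have \<pi>onto: "\<pi> ` carrier Q = carrier K"
  proof -
    have "carrier (Q Mod D) = (\<lambda>x. D #>\<^bsub>Q\<^esub> x) ` carrier Q"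
      by (auto simp: FactGroup_def RCOSETS_def)
    then have "\<pi> ` carrier Q = h ` carrier (Q Mod D)"
      by (auto simp: \<pi>_def)
    then show ?thesis using h by (auto simp: iso_def bij_betw_def)
  qed
  have \<pi>D: "\<pi> x = \<one>\<^bsub>K\<^esub>" if "x \<in> D" for x
  proof -
    have "h D = \<one>\<^bsub>K\<^esub>"
      using hom_one[of h "Q Mod D" K] h normal.factorgroup_is_group[OF Dn] K.group_axioms
      by (simp add: iso_def)
    then show ?thesis
      using Q.coset_join2[of x D] that Dsub subgroup.mem_carrier[OF Dsub] by (simp add: \<pi>_def)
  qed
  define b where "b = inv_into (carrier Q) \<pi>"
  have b: "b a \<in> carrier Q" "\<pi> (b a) = a" if "a \<in> carrier K" for a
    using that inv_into_into[of a \<pi> "carrier Q"] f_inv_into_f[of a \<pi> "carrier Q"]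
    by (simp_all add: b_def \<pi>onto)
  obtain \<beta> where \<beta>: "\<beta> \<in> hom F Q" "\<And>a. a \<in> carrier K \<Longrightarrow> \<beta> (frag_of a) = b a"
    using Q.free_Abelian_group_universal[of b "carrier K"] b(1) unfolding F_def by blast
  define \<phi> where "\<phi> x = (\<lambda>i. \<beta> (x i) i)" for x :: "nat \<Rightarrow> 'a \<Rightarrow>\<^sub>0 int"
  have Pc: "x \<in> carrier P \<longleftrightarrow> (\<forall>i. x i \<in> carrier F)" for x
    by (auto simp: P_def)
  have \<beta>c: "\<beta> c i \<in> carrier (B i)" if "c \<in> carrier F" for c i
    using hom_in_carrier[OF \<beta>(1) that] by (auto simp: Q_def)
  have \<phi>c: "\<phi> x \<in> carrier Q" if "x \<in> carrier P" for x
    using that \<beta>c by (auto simp: \<phi>_def Pc Q_def)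
  have \<phi>hom: "\<phi> \<in> hom P Q"
  proof (rule homI)
    fix x y assume xy: "x \<in> carrier P" "y \<in> carrier P"
    show "\<phi> (x \<otimes>\<^bsub>P\<^esub> y) = \<phi> x \<otimes>\<^bsub>Q\<^esub> \<phi> y"
    proof
      fix i
      have "\<beta> (x i \<otimes>\<^bsub>F\<^esub> y i) = \<beta> (x i) \<otimes>\<^bsub>Q\<^esub> \<beta> (y i)"
        using hom_mult[OF \<beta>(1)] xy by (simp add: Pc)
      then show "\<phi> (x \<otimes>\<^bsub>P\<^esub> y) i = (\<phi> x \<otimes>\<^bsub>Q\<^esub> \<phi> y) i"
        by (simp add: \<phi>_def P_def Q_def)
    qed
  qed (rule \<phi>c)
  define \<psi> where "\<psi> = \<pi> \<circ> \<phi>"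
  have \<psi>hom: "\<psi> \<in> hom P K"
    unfolding \<psi>_def by (rule hom_compose[OF \<phi>hom \<pi>hom])
  have "\<psi> \<in> epi P K"
    unfolding epi_iff_subset
  proof (intro conjI \<psi>hom subsetI)
    fix a assume a: "a \<in> carrier K"
    have "(\<lambda>_. frag_of a) \<in> carrier P" using a by (simp add: Pc F_def)
    moreover have "\<psi> (\<lambda>_. frag_of a) = a"
      using a \<beta>(2) b(2) by (simp add: \<psi>_def \<phi>_def)
    ultimately show "a \<in> \<psi> ` carrier P" by (metis imageI)
  qed
  moreover have "\<psi> (\<lambda>j. if j = i then c else 0) = \<one>\<^bsub>K\<^esub>" if c: "c \<in> carrier F" for i c
  proof -
    have "\<beta> 0 = \<one>\<^bsub>Q\<^esub>"
      using hom_one[OF \<beta>(1) F.group_axioms Q.group_axioms] by (simp add: F_def)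
    then have "\<phi> (\<lambda>j. if j = i then c else 0) = (\<lambda>j. if j = i then \<beta> c i else \<one>\<^bsub>B j\<^esub>)"
      by (auto simp: \<phi>_def Q_def)
    also have "\<dots> \<in> D"
      unfolding D_def Q_def by (rule single_in_tower_shift[OF tower \<beta>c[OF c]])
    finally show ?thesis using \<pi>D by (simp add: \<psi>_def)
  qed
  ultimately show ?thesis
    using cotorsion_group_if_epi[OF K, of \<psi> "carrier K"] unfolding P_def F_def by blast
qed

end

theory Submission
  imports Defs "HOL-Library.Nat_Bijection"
begin

text \<open>
  Take $A_i = \mathbb{Z}/2^i \oplus C$, where $C = \bigoplus_{j>0} C_j$ for reduced 2-groups $C_j$ with
  first Ulm subgroup $\bigcap_i 2^i C_j \cong \mathbb{Z}/2^j$, generated by $c_j$ (a further sum of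
  cyclic groups in the construction below plays no role). For commuting $x, y$ let
  $\langle x, y\rangle = [x|y] - [y|x]$, which is bilinear in $H_2$ of an abelian group. If $b$ is the
  generator of $\mathbb{Z}_2 = \varprojlim \mathbb{Z}/2^i$, then $\langle b, c_n\rangle$ dies in every
  $H_2(A_i)$, since there $2^i b = 0$ and $c_n \in 2^i C$. If the kernel were cotorsion, the equations
  $x_n = 2 x_{n+1} + \langle b, c_{n+1}\rangle$ would have a solution in it. The bilinear map
  $(x, y) \mapsto x_{\mathbb{Z}_2} \cdot y_C$ is a 2-cocycle and carries this solution to a solution of
  $u_n = 2 u_{n+1} + c_{n+1}$ in $C$. Reducedness determines $u_0$, whose component at each $j > 0$
  would be $2^{j-1} c_j \neq 0$, but an element of the direct sum has finite support.
\<close>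

section \<open>Solving x_n = 2 x_{n+1} + k_n in lim^1\<close>

lemma truncation_in_tower_shift:
  assumes tower: "abelian_tower B g" and q: "q \<in> carrier (product_group UNIV B)"
  shows "(\<lambda>i. if i < n then q i else \<one>\<^bsub>B i\<^esub>) \<in> tower_shift B g ` carrier (product_group UNIV B)"
proof (induction n)
  note sub = tower_shift_subgroup[OF tower]
  have gr: "group (B i)" for i
    using tower by (simp add: abelian_tower_def comm_group.axioms(2))
  have qi: "q i \<in> carrier (B i)" for i using q by auto
  {
    case 0
    show ?case using subgroup.one_closed[OF sub] by (simp add: restrict_def)
  next
    case (Suc n)
    \<comment> \<open>Splitting off one coordinate at a time makes the truncation a finite product
      of single-coordinate sequences, each in the image of the shift. Hence lim^1 does not see
      finite initial segments.\<close>
    have "(\<lambda>i. if i < Suc n then q i else \<one>\<^bsub>B i\<^esub>) =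
        (\<lambda>i. if i < n then q i else \<one>\<^bsub>B i\<^esub>) \<otimes>\<^bsub>product_group UNIV B\<^esub> (\<lambda>i. if i = n then q n else \<one>\<^bsub>B i\<^esub>)"
      using qi gr by (auto simp: fun_eq_iff group.is_monoid less_Suc_eq)
    then show ?case
      using subgroup.m_closed[OF sub Suc.IH single_in_tower_shift[OF tower qi]] by simp
  }
qed

text \<open>
  This is the vanishing of $\mathrm{Ext}(\mathbb{Z}[1/2], K)$. In $\varprojlim^1 B_i$ the element
  \<open>k n\<close> can be represented by a sequence vanishing in the first \<open>n\<close> coordinates, so that the
  formal solution $\sum_m 2^m k_{n+m}$ is a finite sum in each coordinate.
\<close>

lemma cotorsion_group_solution:
  fixes K :: "('a, 'm) monoid_scheme"
  assumes K: "cotorsion_group K"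
    and closed: "\<And>x y. x \<in> carrier K \<Longrightarrow> y \<in> carrier K \<Longrightarrow> x \<otimes>\<^bsub>K\<^esub> y \<in> carrier K"
    and k: "\<And>n. k n \<in> carrier K"
  shows "\<exists>x. \<forall>n :: nat. x n \<in> carrier K \<and> x n = x (Suc n) \<otimes>\<^bsub>K\<^esub> x (Suc n) \<otimes>\<^bsub>K\<^esub> k n"
proof -
  obtain B :: "nat \<Rightarrow> (nat \<Rightarrow> 'a \<Rightarrow>\<^sub>0 int) monoid" and g h
    where tower: "abelian_tower B g" and h: "h \<in> iso K (tower_lim1 B g)"
    using K by (auto simp: cotorsion_group_def is_iso_def)
  define Q where "Q = product_group UNIV B"
  define D where "D = tower_shift B g ` carrier Q"
  have cg: "comm_group (B i)" for i using tower by (simp add: abelian_tower_def)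
  have gr: "group (B i)" for i using cg by (simp add: comm_group.axioms(2))
  interpret Q: comm_group Q
    unfolding Q_def by (rule comm_group_product_group) (rule cg)
  have Dsub: "subgroup D Q"
    unfolding D_def Q_def by (rule tower_shift_subgroup[OF tower])
  then have Dn: "D \<lhd> Q" by (simp add: Q.normal_iff_subgroup)
  define T where "T = Q Mod D"
  define \<pi> where "\<pi> = (\<lambda>q. D #>\<^bsub>Q\<^esub> q)"
  have hT: "h \<in> hom K T" "bij_betw h (carrier K) (carrier T)"
    using h by (simp_all add: T_def D_def Q_def tower_lim1_def iso_def)
  have \<pi>hom: "\<pi> \<in> hom Q T"
    unfolding \<pi>_def T_def by (rule normal.r_coset_hom_Mod[OF Dn])
  have \<pi>onto: "\<exists>q \<in> carrier Q. t = \<pi> q" if "t \<in> carrier T" for t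
    using that by (auto simp: T_def \<pi>_def FactGroup_def RCOSETS_def)
  have "\<exists>q \<in> carrier Q. h (k n) = \<pi> q" for n
    using \<pi>onto hT(1) k by (simp add: hom_in_carrier)
  then obtain q where q: "\<And>n. q n \<in> carrier Q" "\<And>n. h (k n) = \<pi> (q n)" by metis
  have qc: "q n i \<in> carrier (B i)" for n i using q(1)[of n] by (auto simp: Q_def)
  \<comment> \<open>Trivialising the first n coordinates changes \<open>q n\<close> by a truncation
    lying in \<open>D\<close>, so \<open>q' n\<close> still represents
    \<open>h (k n)\<close>.\<close>
  define q' where "q' n = (\<lambda>i. if i < n then \<one>\<^bsub>B i\<^esub> else q n i)" for n
  have q'c: "q' n i \<in> carrier (B i)" for n i
    using qc gr by (simp add: q'_def group.is_monoid)
  then have q'Q: "q' n \<in> carrier Q" for n by (auto simp: Q_def)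
  have q'\<pi>: "\<pi> (q' n) = h (k n)" for n
  proof -
    let ?d = "\<lambda>i. if i < n then q n i else \<one>\<^bsub>B i\<^esub>"
    have d: "?d \<in> D"
      unfolding D_def Q_def
      by (rule truncation_in_tower_shift[OF tower]) (use q(1) in \<open>simp add: Q_def\<close>)
    have "q n = ?d \<otimes>\<^bsub>Q\<^esub> q' n"
      using qc gr by (auto simp: fun_eq_iff Q_def q'_def group.is_monoid)
    then have "\<pi> (q n) = (D #>\<^bsub>Q\<^esub> ?d) #>\<^bsub>Q\<^esub> q' n"
      unfolding \<pi>_def
      using Q.coset_mult_assoc[of D ?d "q' n"] subgroup.subset[OF Dsub] subgroup.mem_carrier[OF Dsub d] q'Q
      by simp
    then show ?thesis
      using Q.coset_join2[OF subgroup.mem_carrier[OF Dsub d] Dsub d] q(2) by (simp add: \<pi>_def)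
  qed
  \<comment> \<open>\<open>Y i d\<close> is coordinate i of the solution at index i + 1 - d: it is
    computed backwards from the value \<open>\<one>\<close> at index i + 1.\<close>
  define Y where "Y i = rec_nat \<one>\<^bsub>B i\<^esub> (\<lambda>d y. y \<otimes>\<^bsub>B i\<^esub> y \<otimes>\<^bsub>B i\<^esub> q' (i - d) i)" for i
  have Yc: "Y i d \<in> carrier (B i)" for i d
    by (induction d) (use gr q'c in \<open>auto simp: Y_def group.is_monoid monoid.m_closed\<close>)
  \<comment> \<open>For n > i the truncated subtraction gives 0, so \<open>X n i\<close> is
    \<open>\<one>\<close>; this is consistent because \<open>q' n i\<close> is trivial
    there.\<close>
  define X where "X n = (\<lambda>i. Y i (Suc i - n))" for n
  have XQ: "X n \<in> carrier Q" for n using Yc by (auto simp: X_def Q_def)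
  have Xstep: "X n = X (Suc n) \<otimes>\<^bsub>Q\<^esub> X (Suc n) \<otimes>\<^bsub>Q\<^esub> q' n" for n
  proof
    fix i
    show "X n i = (X (Suc n) \<otimes>\<^bsub>Q\<^esub> X (Suc n) \<otimes>\<^bsub>Q\<^esub> q' n) i"
    proof (cases "n \<le> i")
      case True
      then have "Suc i - n = Suc (i - n)" "i - (i - n) = n" by auto
      then show ?thesis by (simp add: X_def Y_def Q_def)
    next
      case False
      then show ?thesis using gr[of i] by (simp add: X_def Y_def Q_def q'_def group.is_monoid)
    qed
  qed
  define y where "y n = \<pi> (X n)" for n
  have yT: "y n \<in> carrier T" for n
    unfolding y_def by (rule hom_in_carrier[OF \<pi>hom XQ])
  have ystep: "y n = y (Suc n) \<otimes>\<^bsub>T\<^esub> y (Suc n) \<otimes>\<^bsub>T\<^esub> h (k n)" for n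
  proof -
    have "y n = \<pi> (X (Suc n) \<otimes>\<^bsub>Q\<^esub> X (Suc n) \<otimes>\<^bsub>Q\<^esub> q' n)"
      unfolding y_def using Xstep[of n] by simp
    then show ?thesis
      using XQ q'Q by (simp add: hom_mult[OF \<pi>hom] y_def q'\<pi>)
  qed
  define x where "x n = inv_into (carrier K) h (y n)" for n
  have onto: "h ` carrier K = carrier T" and inj: "inj_on h (carrier K)"
    using hT(2) by (auto simp: bij_betw_def)
  have x: "x n \<in> carrier K" "h (x n) = y n" for n
    using yT onto by (simp_all add: x_def inv_into_into f_inv_into_f)
  have "x n = x (Suc n) \<otimes>\<^bsub>K\<^esub> x (Suc n) \<otimes>\<^bsub>K\<^esub> k n" for n
    by (rule inj_onD[OF inj]) (simp_all add: x closed k hom_mult[OF hT(1)] ystep[of n])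
  with x(1) show ?thesis by blast
qed

section \<open>The bar complex in low degrees\<close>

lemma bar_boundary_diff: "bar_boundary G (c - d) = bar_boundary G c - bar_boundary G d"
  by (simp add: bar_boundary_def frag_extend_diff)

lemma bar_boundary_add: "bar_boundary G (c + d) = bar_boundary G c + bar_boundary G d"
  by (simp add: bar_boundary_def frag_extend_add)

lemma bar_boundary_frag_of_2:
  "bar_boundary G (frag_of [x, y]) = frag_of [y] - frag_of [x \<otimes>\<^bsub>G\<^esub> y] + frag_of [x]"
  by (simp add: bar_boundary_def bar_face_def numeral_2_eq_2)

lemma bar_boundary_frag_of_3:
  "bar_boundary G (frag_of [x, y, z]) =
    frag_of [y, z] - frag_of [x \<otimes>\<^bsub>G\<^esub> y, z] + frag_of [x, y \<otimes>\<^bsub>G\<^esub> z] - frag_of [x, y]"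
  by (simp add: bar_boundary_def bar_face_def eval_nat_numeral)

lemma zero_in_bar_boundaries: "0 \<in> bar_boundaries n G"
  by (force simp: bar_boundaries_def bar_chain_group_def bar_boundary_def)

lemma diff_in_bar_boundaries:
  assumes "c \<in> bar_boundaries n G" "d \<in> bar_boundaries n G"
  shows "c - d \<in> bar_boundaries n G"
proof -
  obtain c' d' where "c' \<in> carrier (bar_chain_group (Suc n) G)" "d' \<in> carrier (bar_chain_group (Suc n) G)"
      "c = bar_boundary G c'" "d = bar_boundary G d'"
    using assms by (auto simp: bar_boundaries_def)
  moreover from this have "c' - d' \<in> carrier (bar_chain_group (Suc n) G)"
    using keys_diff[of c' d'] by (auto simp: bar_chain_group_def)
  ultimately show ?thesis
    by (auto simp: bar_boundaries_def simp flip: bar_boundary_diff)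
qed

lemma minus_in_bar_boundaries: "c \<in> bar_boundaries n G \<Longrightarrow> - c \<in> bar_boundaries n G"
  using diff_in_bar_boundaries[OF zero_in_bar_boundaries] by force

lemma add_in_bar_boundaries:
  "c \<in> bar_boundaries n G \<Longrightarrow> d \<in> bar_boundaries n G \<Longrightarrow> c + d \<in> bar_boundaries n G"
  using diff_in_bar_boundaries[OF _ minus_in_bar_boundaries] by force

section \<open>Homology classes as cosets of boundaries\<close>

lemma bar_coset_eq: "bar_boundaries n G #>\<^bsub>bar_chain_group n G\<^esub> c = (\<lambda>b. b + c) ` bar_boundaries n G"
  by (auto simp: r_coset_def bar_chain_group_def)

lemma bar_coset_eq_iff:
  "(\<lambda>b. b + c) ` bar_boundaries n G = (\<lambda>b. b + d) ` bar_boundaries n G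
    \<longleftrightarrow> c - d \<in> bar_boundaries n G" (is "?l = ?r \<longleftrightarrow> _")
proof
  assume "?l = ?r"
  moreover have "c \<in> ?l" using zero_in_bar_boundaries by force
  ultimately obtain b where "b \<in> bar_boundaries n G" "c = b + d" by auto
  then show "c - d \<in> bar_boundaries n G" by simp
next
  assume cd: "c - d \<in> bar_boundaries n G"
  have "b + c \<in> ?r" if "b \<in> bar_boundaries n G" for b
    by (rule image_eqI[where x = "b + (c - d)"]) (simp_all add: add_in_bar_boundaries cd that)
  moreover have "b + d \<in> ?l" if "b \<in> bar_boundaries n G" for b
    by (rule image_eqI[where x = "b - (c - d)"]) (simp_all add: diff_in_bar_boundaries cd that)
  ultimately show "?l = ?r" by blast
qed

lemma carrier_group_homology:
  "carrier (group_homology n G) = (\<lambda>c. (\<lambda>b. b + c) ` bar_boundaries n G) ` bar_cycles n G"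
  by (auto simp: group_homology_def FactGroup_def RCOSETS_def r_coset_def bar_chain_group_def)

lemma one_group_homology: "\<one>\<^bsub>group_homology n G\<^esub> = bar_boundaries n G"
  by (simp add: group_homology_def FactGroup_def)

lemma mult_group_homology:
  "(\<lambda>b. b + c) ` bar_boundaries n G \<otimes>\<^bsub>group_homology n G\<^esub> (\<lambda>b. b + d) ` bar_boundaries n G
    = (\<lambda>b. b + (c + d)) ` bar_boundaries n G" (is "?l = ?r")
proof -
  have "?l = {b + c + (b' + d) | b b'. b \<in> bar_boundaries n G \<and> b' \<in> bar_boundaries n G}"
    by (auto simp: group_homology_def FactGroup_def set_mult_def bar_chain_group_def)
  also have "\<dots> = ?r"
  proof (intro equalityI subsetI)
    fix x assume "x \<in> {b + c + (b' + d) | b b'. b \<in> bar_boundaries n G \<and> b' \<in> bar_boundaries n G}"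
    then obtain b b' where b: "b \<in> bar_boundaries n G" "b' \<in> bar_boundaries n G" "x = b + c + (b' + d)"
      by blast
    show "x \<in> ?r"
      by (rule image_eqI[where x = "b + b'"]) (simp_all add: b add_in_bar_boundaries)
  next
    fix x assume "x \<in> ?r"
    then obtain b where "b \<in> bar_boundaries n G" "x = b + c + (0 + d)" by (auto simp: add.assoc)
    then show "x \<in> {b + c + (b' + d) | b b'. b \<in> bar_boundaries n G \<and> b' \<in> bar_boundaries n G}"
      using zero_in_bar_boundaries by blast
  qed
  finally show ?thesis .
qed

lemma list_of_length_3: "length xs = 3 \<longleftrightarrow> (\<exists>x y z. xs = [x, y, z])"
  by (auto simp: numeral_3_eq_3 length_Suc_conv)

text \<open>A degree-3 chain is an integral combination of triples, so boundaries of single triples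
  generate all 2-boundaries under subtraction. Checks on boundaries thus reduce to one four-term
  relation.\<close>

lemma bar_boundaries_2_induct [consumes 1, case_names boundary zero diff]:
  assumes c: "c \<in> bar_boundaries 2 G"
    and boundary: "\<And>x y z. x \<in> carrier G \<Longrightarrow> y \<in> carrier G \<Longrightarrow> z \<in> carrier G \<Longrightarrow>
      P (frag_of [y, z] - frag_of [x \<otimes>\<^bsub>G\<^esub> y, z] + frag_of [x, y \<otimes>\<^bsub>G\<^esub> z] - frag_of [x, y])"
    and zero: "P 0" and diff: "\<And>c d. P c \<Longrightarrow> P d \<Longrightarrow> P (c - d)"
  shows "P c"
proof -
  obtain d where d: "Poly_Mapping.keys d \<subseteq> {xs. length xs = 3 \<and> set xs \<subseteq> carrier G}"
    and cd: "c = bar_boundary G d"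
    using c by (auto simp: bar_boundaries_def bar_chain_group_def eval_nat_numeral)
  have "P (bar_boundary G d)"
    using d
  proof (induction d rule: frag_induction)
    case zero
    show ?case using assms(3) by (simp add: bar_boundary_def)
  next
    case (one xs)
    then obtain x y z where "xs = [x, y, z]" "{x, y, z} \<subseteq> carrier G"
      by (auto simp: list_of_length_3)
    then show ?case using boundary by (simp add: bar_boundary_frag_of_3)
  next
    case (diff a b)
    then show ?case using assms(4) by (simp add: bar_boundary_diff)
  qed
  then show ?thesis by (simp add: cd)
qed

lemma bar_boundary_relation:
  assumes "x \<in> carrier G" "y \<in> carrier G" "z \<in> carrier G"
  shows "frag_of [y, z] - frag_of [x \<otimes>\<^bsub>G\<^esub> y, z] + frag_of [x, y \<otimes>\<^bsub>G\<^esub> z] - frag_of [x, y]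
    \<in> bar_boundaries 2 G"
  unfolding bar_boundaries_def
  by (rule image_eqI[where x = "frag_of [x, y, z]"])
    (use assms in \<open>simp_all add: bar_boundary_frag_of_3 bar_chain_group_def\<close>)

lemma bar_boundaries_2_map:
  assumes h: "h \<in> hom G H" and c: "c \<in> bar_boundaries 2 G"
  shows "frag_extend (frag_of \<circ> map h) c \<in> bar_boundaries 2 H"
  using c
proof (induction c rule: bar_boundaries_2_induct)
  case (boundary x y z)
  then show ?case
    using bar_boundary_relation[of "h x" H "h y" "h z"] hom_in_carrier[OF h]
    by (simp add: frag_extend_diff frag_extend_add hom_mult[OF h])
qed (simp_all add: frag_extend_diff diff_in_bar_boundaries zero_in_bar_boundaries)

section \<open>The image of x \<and> y in H_2 of an abelian group\<close>

definition commutator_chain :: "'a \<Rightarrow> 'a \<Rightarrow> 'a list \<Rightarrow>\<^sub>0 int"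
  where "commutator_chain x y = frag_of [x, y] - frag_of [y, x]"

lemma commutator_chain_swap: "commutator_chain y x = - commutator_chain x y"
  by (simp add: commutator_chain_def)

text \<open>The difference is the boundary of the signed shuffles
  \<open>[x|y|z] - [y|x|z] + [y|z|x]\<close> of x into \<open>[y|z]\<close>; commutativity
  identifies the faces that have to cancel.\<close>

lemma commutator_chain_mult:
  assumes G: "comm_group G" and xyz: "x \<in> carrier G" "y \<in> carrier G" "z \<in> carrier G"
  shows "commutator_chain x (y \<otimes>\<^bsub>G\<^esub> z) - (commutator_chain x y + commutator_chain x z)
    \<in> bar_boundaries 2 G"
proof -
  interpret comm_group G by (rule G)
  have "commutator_chain x (y \<otimes>\<^bsub>G\<^esub> z) - (commutator_chain x y + commutator_chain x z) =
      (frag_of [y, z] - frag_of [x \<otimes>\<^bsub>G\<^esub> y, z] + frag_of [x, y \<otimes>\<^bsub>G\<^esub> z] - frag_of [x, y])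
    - (frag_of [x, z] - frag_of [y \<otimes>\<^bsub>G\<^esub> x, z] + frag_of [y, x \<otimes>\<^bsub>G\<^esub> z] - frag_of [y, x])
    + (frag_of [z, x] - frag_of [y \<otimes>\<^bsub>G\<^esub> z, x] + frag_of [y, z \<otimes>\<^bsub>G\<^esub> x] - frag_of [y, z])"
    using xyz m_comm[of x y] m_comm[of x z] by (simp add: commutator_chain_def)
  then show ?thesis
    by (simp only: add_in_bar_boundaries diff_in_bar_boundaries bar_boundary_relation xyz)
qed

lemma commutator_chain_one:
  assumes G: "comm_group G" and x: "x \<in> carrier G"
  shows "commutator_chain x \<one>\<^bsub>G\<^esub> \<in> bar_boundaries 2 G"
proof -
  interpret comm_group G by (rule G)
  show ?thesis
    \<comment> \<open>With both factors equal to \<open>\<one>\<close> the relation reads <x, 1> - 2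
      <x, 1>.\<close>
    using minus_in_bar_boundaries[OF commutator_chain_mult[OF G x one_closed one_closed]] by simp
qed

lemma commutator_chain_pow:
  fixes m :: nat
  assumes G: "comm_group G" and xy: "x \<in> carrier G" "y \<in> carrier G"
  shows "commutator_chain x (y [^]\<^bsub>G\<^esub> m) - frag_cmul (int m) (commutator_chain x y)
    \<in> bar_boundaries 2 G"
proof -
  interpret comm_group G by (rule G)
  show ?thesis
  proof (induction m)
    case 0
    show ?case using commutator_chain_one[OF G xy(1)] by simp
  next
    case (Suc m)
    have "commutator_chain x (y [^]\<^bsub>G\<^esub> Suc m) - frag_cmul (int (Suc m)) (commutator_chain x y) =
        (commutator_chain x (y [^]\<^bsub>G\<^esub> m \<otimes>\<^bsub>G\<^esub> y) - (commutator_chain x (y [^]\<^bsub>G\<^esub> m) + commutator_chain x y))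
      + (commutator_chain x (y [^]\<^bsub>G\<^esub> m) - frag_cmul (int m) (commutator_chain x y))"
      by (simp add: frag_cmul_distrib)
    then show ?case
      using Suc.IH commutator_chain_mult[OF G xy(1) nat_pow_closed[OF xy(2)] xy(2), of m]
      by (simp only: add_in_bar_boundaries)
  qed
qed

text \<open>Antisymmetry moves the exponent across, so that additivity in the second argument
  suffices: <x, y^m> = m <x, y> = - m <y, x> = - <y, x^m> = - <y, 1> = 0. This kills <b, c_n> at
  every finite level.\<close>

lemma commutator_chain_annihilated:
  fixes m :: nat
  assumes G: "comm_group G" and xy: "x \<in> carrier G" "y \<in> carrier G"
    and x: "x [^]\<^bsub>G\<^esub> m = \<one>\<^bsub>G\<^esub>"
  shows "commutator_chain x (y [^]\<^bsub>G\<^esub> m) \<in> bar_boundaries 2 G"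
proof -
  have "(commutator_chain x (y [^]\<^bsub>G\<^esub> m) - frag_cmul (int m) (commutator_chain x y))
    + ((commutator_chain y (x [^]\<^bsub>G\<^esub> m) - frag_cmul (int m) (commutator_chain y x))
    - commutator_chain y \<one>\<^bsub>G\<^esub>) \<in> bar_boundaries 2 G"
    by (intro add_in_bar_boundaries diff_in_bar_boundaries commutator_chain_pow
        commutator_chain_one G xy)
  moreover have "commutator_chain y x = - commutator_chain x y"
    by (rule commutator_chain_swap)
  moreover have "frag_cmul (int m) (- commutator_chain x y) = - frag_cmul (int m) (commutator_chain x y)"
    by (simp add: poly_mapping_eq_iff fun_eq_iff)
  ultimately show ?thesis by (simp add: x)
qed

lemma commutator_chain_in_bar_cycles:
  assumes "x \<in> carrier G" "y \<in> carrier G" "x \<otimes>\<^bsub>G\<^esub> y = y \<otimes>\<^bsub>G\<^esub> x"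
  shows "commutator_chain x y \<in> bar_cycles 2 G"
  using assms keys_diff[of "frag_of [x, y]" "frag_of [y, x]"]
  by (auto simp: bar_cycles_def bar_chain_group_def commutator_chain_def
      bar_boundary_diff bar_boundary_frag_of_2)

lemma frag_extend_commutator_chain:
  "frag_extend (frag_of \<circ> map h) (commutator_chain x y) = commutator_chain (h x) (h y)"
  by (simp add: commutator_chain_def frag_extend_diff)

lemma add_in_bar_cycles:
  assumes "c \<in> bar_cycles n G" "d \<in> bar_cycles n G"
  shows "c + d \<in> bar_cycles n G"
  using assms subset_trans[OF Poly_Mapping.keys_add[of c d] Un_least]
  by (simp add: bar_cycles_def bar_chain_group_def bar_boundary_add)

section \<open>Induced maps on H_2 and the kernel of the limit map\<close>

lemma group_homology_map_coset:
  assumes h: "h \<in> hom G H"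
  shows "group_homology_map 2 H h ((\<lambda>b. b + c) ` bar_boundaries 2 G) =
    (\<lambda>b. b + frag_extend (frag_of \<circ> map h) c) ` bar_boundaries 2 H"
proof -
  let ?h = "frag_extend (frag_of \<circ> map h)"
  have "(\<lambda>b'. b' + ?h (b + c)) ` bar_boundaries 2 H = (\<lambda>b'. b' + ?h c) ` bar_boundaries 2 H"
    if "b \<in> bar_boundaries 2 G" for b
    using bar_boundaries_2_map[OF h that] by (simp add: bar_coset_eq_iff frag_extend_add)
  \<comment> \<open>Changing the representative does not change the image coset, so the set under
    \<open>the_elem\<close> is a singleton.\<close>
  then have "(\<lambda>c. bar_boundaries 2 H #>\<^bsub>bar_chain_group 2 H\<^esub> ?h c) ` (\<lambda>b. b + c) ` bar_boundaries 2 G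
      = {(\<lambda>b'. b' + ?h c) ` bar_boundaries 2 H}"
    using zero_in_bar_boundaries by (fastforce simp: bar_coset_eq)
  then show ?thesis by (simp add: group_homology_map_def)
qed

lemma one_tower_lim: "\<one>\<^bsub>tower_lim A f\<^esub> = (\<lambda>i. \<one>\<^bsub>A i\<^esub>)"
  by (simp add: tower_lim_def restrict_def)

text \<open>Replaces classes by cycles: membership in the kernel becomes a condition on the
  projections of one representative.\<close>

lemma kernel_homology_lim_map:
  "kernel (group_homology 2 (tower_lim A f))
      (tower_lim (\<lambda>i. group_homology 2 (A i)) (\<lambda>i. group_homology_map 2 (A i) (f i)))
      (homology_lim_map 2 A)
    = (\<lambda>c. (\<lambda>b. b + c) ` bar_boundaries 2 (tower_lim A f)) `
      {c \<in> bar_cycles 2 (tower_lim A f).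
        \<forall>i. frag_extend (frag_of \<circ> map (\<lambda>x. x i)) c \<in> bar_boundaries 2 (A i)}"
proof -
  have proj: "(\<lambda>x. x i) \<in> hom (tower_lim A f) (A i)" for i
    by (rule homI) (auto simp: tower_lim_def)
  have "homology_lim_map 2 A ((\<lambda>b. b + c) ` bar_boundaries 2 (tower_lim A f)) =
      \<one>\<^bsub>tower_lim (\<lambda>i. group_homology 2 (A i)) (\<lambda>i. group_homology_map 2 (A i) (f i))\<^esub>
    \<longleftrightarrow> (\<forall>i. frag_extend (frag_of \<circ> map (\<lambda>x. x i)) c \<in> bar_boundaries 2 (A i))" for c
  proof -
    have "(\<lambda>b. b + d) ` bar_boundaries 2 (A i) = bar_boundaries 2 (A i)
        \<longleftrightarrow> d \<in> bar_boundaries 2 (A i)" for d i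
      using bar_coset_eq_iff[of d 2 "A i" 0] by simp
    then show ?thesis
      by (simp add: homology_lim_map_def group_homology_map_coset[OF proj] one_tower_lim
          one_group_homology fun_eq_iff)
  qed
  then show ?thesis by (auto simp: kernel_def carrier_group_homology)
qed

section \<open>A tower of countable 2-groups\<close>

abbreviation lookup :: "('a \<Rightarrow>\<^sub>0 int) \<Rightarrow> 'a \<Rightarrow> int"
  where "lookup \<equiv> poly_mapping.lookup"

text \<open>If \<open>2 ^ k\<close> divides each entry (j, k), the relations 2^k e_{j,k} = e_{j,0}
  turn row j into \<open>row_sum j x\<close> times e_{j,0}.\<close>

definition row_sum :: "nat \<Rightarrow> (nat \<times> nat \<Rightarrow>\<^sub>0 int) \<Rightarrow> int"
  where "row_sum j x = Sum_any (\<lambda>k. lookup x (j, k) div 2 ^ k)"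

text \<open>
  Writing $e_{j,k}$ for the basis, the quotient of the free abelian group by \<open>relators i\<close> is the sum
  of $\mathbb{Z}/2^i$ (generated by $e_{0,0}$), of cyclic groups (the rest of row 0), and for each
  $j > 0$ of the reduced group with relations $2^k e_{j,k} = e_{j,0}$ and $2^j e_{j,0} = 0$, in which
  $e_{j,0} \neq 0$ is divisible by every power of 2.
\<close>

definition relators :: "nat \<Rightarrow> (nat \<times> nat \<Rightarrow>\<^sub>0 int) set"
  where "relators i = {x. 2 ^ i dvd lookup x (0, 0) \<and> (\<forall>j k. 2 ^ k dvd lookup x (j, k)) \<and>
    (\<forall>j. 2 ^ j dvd row_sum j x)}"

lemma finite_row: "finite {k. lookup x (j, k) \<noteq> 0}" for x :: "nat \<times> nat \<Rightarrow>\<^sub>0 int"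
proof -
  have "{k. lookup x (j, k) \<noteq> 0} = Pair j -` Poly_Mapping.keys x"
    by (auto simp: in_keys_iff)
  then show ?thesis by (simp add: finite_vimageI inj_on_def)
qed

lemma finite_row_div: "finite {k. lookup x (j, k) div 2 ^ k \<noteq> 0}" for x :: "nat \<times> nat \<Rightarrow>\<^sub>0 int"
  by (rule finite_subset[OF _ finite_row[of x j]]) auto

text \<open>Integer division by \<open>2 ^ k\<close> splits over a sum as soon as one summand is
  divisible.\<close>

lemma row_sum_add:
  assumes "\<And>k. 2 ^ k dvd lookup x (j, k)"
  shows "row_sum j (x + y) = row_sum j x + row_sum j y"
  unfolding row_sum_def
  by (subst Sum_any.distrib[symmetric, OF finite_row_div finite_row_div])
    (simp add: lookup_add div_plus_div_distrib_dvd_left assms)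

lemma dvd_Sum_any: "(\<And>k. m dvd f k) \<Longrightarrow> m dvd Sum_any f" for f :: "'a \<Rightarrow> int"
  by (simp add: Sum_any.expand_set dvd_sum)

lemma row_sum_frag_of: "row_sum j (frag_of (a, 0)) = (if j = a then 1 else 0)"
proof -
  have "row_sum j (frag_of (a, 0)) = Sum_any (\<lambda>k :: nat. (if j = a then 1 else 0) when k = 0)"
    unfolding row_sum_def by (rule Sum_any.cong) (auto simp: lookup_single when_def)
  then show ?thesis by simp
qed

lemma zero_in_relators: "0 \<in> relators i"
  by (simp add: relators_def row_sum_def)

lemma diff_in_relators:
  assumes x: "x \<in> relators i" and y: "y \<in> relators i"
  shows "x - y \<in> relators i"
proof -
  have d: "2 ^ k dvd lookup (x - y) (j, k)" for j k
    using x y by (auto simp: relators_def lookup_minus)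
  have "row_sum j (x - y) = row_sum j x - row_sum j y" for j
    using row_sum_add[of "x - y" j y] d by simp
  with x y d show ?thesis by (auto simp: relators_def lookup_minus)
qed

lemma minus_in_relators: "x \<in> relators i \<Longrightarrow> - x \<in> relators i"
  using diff_in_relators[OF zero_in_relators] by force

lemma add_in_relators: "x \<in> relators i \<Longrightarrow> y \<in> relators i \<Longrightarrow> x + y \<in> relators i"
  using diff_in_relators[OF _ minus_in_relators] by force

lemma relators_antimono: "i \<le> i' \<Longrightarrow> relators i' \<subseteq> relators i"
  by (auto simp: relators_def intro: power_le_dvd)

lemma relator_0: "frag_cmul (2 ^ i) (frag_of (0, 0)) \<in> relators i"
proof -
  have "lookup (frag_cmul (2 ^ i) (frag_of (0, 0))) (j, k) div 2 ^ k = 0" if "j \<noteq> 0" for j k :: nat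
    using that by (simp add: lookup_single)
  then have "2 ^ j dvd row_sum j (frag_cmul (2 ^ i) (frag_of (0, 0)))" for j
    by (cases "j = 0") (simp_all add: row_sum_def)
  then show ?thesis by (auto simp: relators_def lookup_single when_def)
qed

text \<open>The two entries contribute 1 and -1 to the row sum of row n. This is what makes c_n
  divisible by every \<open>2 ^ i\<close>.\<close>

lemma relator_power:
  assumes "0 < n"
  shows "frag_of (n, 0) - frag_cmul (2 ^ i) (frag_of (n, i)) \<in> relators i"
proof -
  define x where "x = frag_of (n, 0) - frag_cmul (2 ^ i) (frag_of (n, i))"
  \<comment> \<open>Two separate \<open>when\<close> terms also cover i = 0, where both
    contributions fall on the same entry.\<close>
  have "lookup x (j, k) div 2 ^ k = ((if j = n then 1 else 0) when k = 0) + ((if j = n then - 1 else 0) when k = i)" for j k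
    by (auto simp: x_def lookup_minus lookup_single when_def)
  then have "row_sum j x = Sum_any (\<lambda>k. ((if j = n then 1 else 0) when k = 0) + ((if j = n then - 1 else 0) when k = i))" for j
    by (simp add: row_sum_def)
  also have "\<dots> j = 0" for j
    by (subst Sum_any.distrib) auto
  finally have "row_sum j x = 0" for j .
  then show ?thesis
    unfolding x_def[symmetric]
    using assms by (auto simp: relators_def) (auto simp: x_def lookup_minus lookup_single when_def)
qed

text \<open>Divisibility forces every \<open>u n\<close> into the span of the e_{j,0} modulo the
  relators. There the equations become congruences between row sums, and these fail in a row outside
  the finite support of \<open>u 0\<close>.\<close>

lemma no_divisible_sequence_mod_relators:
  fixes u :: "nat \<Rightarrow> nat \<times> nat \<Rightarrow>\<^sub>0 int"
  assumes u: "\<And>n. u n - (u (Suc n) + u (Suc n) + frag_of (Suc n, 0)) \<in> relators 0"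
  shows False
proof -
  let ?e = "\<lambda>n. frag_of (Suc n, 0) :: nat \<times> nat \<Rightarrow>\<^sub>0 int"
  have e: "2 ^ k dvd lookup (?e n) (j, k)" for n j k
    by (auto simp: lookup_single when_def)
  have du: "2 ^ k dvd lookup (u n) (j, k) - (2 * lookup (u (Suc n)) (j, k) + lookup (?e n) (j, k))" for n j k
    using u[of n] by (auto simp: relators_def lookup_minus lookup_add)
  \<comment> \<open>Reducedness: each use of the equation gains a factor 2 in entry (j, k), until
    \<open>2 ^ k\<close> is reached, the modulus up to which relators control that entry.\<close>
  have "2 ^ min m k dvd lookup (u n) (j, k)" for m n j k
  proof (induction m arbitrary: n)
    case (Suc m)
    show ?case
    proof (cases "m < k")
      case True
      then have "2 ^ Suc m dvd 2 * lookup (u (Suc n)) (j, k)" using Suc.IH[of "Suc n"] by simp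
      moreover have "2 ^ Suc m dvd (2 ^ k :: int)" using True le_imp_power_dvd[of "Suc m" k "2 :: int"] by simp
      ultimately have "2 ^ Suc m dvd (lookup (u n) (j, k) - (2 * lookup (u (Suc n)) (j, k) + lookup (?e n) (j, k)))
          + (2 * lookup (u (Suc n)) (j, k) + lookup (?e n) (j, k))"
        using du[of k n j] e[of k n j] by (meson dvd_add dvd_trans)
      with True show ?thesis by simp
    qed (use Suc.IH[of n] in \<open>simp add: min.absorb2\<close>)
  qed simp
  from this[where m = k and k = k for k] have d: "2 ^ k dvd lookup (u n) (j, k)" for n j k by simp
  \<comment> \<open>Row j of \<open>u n\<close> now equals \<open>v n j\<close> times e_{j,0} modulo
    the relators, and 2^j kills e_{j,0}; hence the modulus 2^j below.\<close>
  define v where "v n j = row_sum j (u n)" for n j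
  have step: "2 ^ j dvd v n j - (2 * v (Suc n) j + (if j = Suc n then 1 else 0))" for n j
  proof -
    let ?r = "u n - (u (Suc n) + u (Suc n) + ?e n)"
    have dr: "2 ^ k dvd lookup ?r (j, k)" for k using u[of n] by (auto simp: relators_def)
    have dd: "2 ^ k dvd lookup (u (Suc n) + u (Suc n)) (j, k)" for k
      using d by (simp add: lookup_add)
    have "v n j = row_sum j (?r + (u (Suc n) + u (Suc n) + ?e n))" by (simp add: v_def)
    also have "\<dots> = row_sum j ?r + (row_sum j (u (Suc n)) + row_sum j (u (Suc n)) + row_sum j (?e n))"
      by (simp only: row_sum_add[OF dr] row_sum_add[OF dd] row_sum_add[OF d])
    finally have "v n j - (2 * v (Suc n) j + (if j = Suc n then 1 else 0)) = row_sum j ?r"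
      by (simp add: v_def row_sum_frag_of)
    then show ?thesis using u[of n] by (simp add: relators_def)
  qed
  \<comment> \<open>Finitely many rows occur in \<open>u 0\<close>; row m + 1 lies beyond
    them.\<close>
  obtain m where m: "\<And>q. q \<in> fst ` Poly_Mapping.keys (u 0) \<Longrightarrow> q < m"
    using finite_nat_set_iff_bounded[of "fst ` Poly_Mapping.keys (u 0)"] by auto
  have z: "v 0 (Suc m) = 0"
  proof -
    have "lookup (u 0) (Suc m, k) = 0" for k
      using m[of "Suc m"] by (force simp: in_keys_iff)
    then show ?thesis by (simp add: v_def row_sum_def)
  qed
  \<comment> \<open>In row m + 1 the term 1 enters only at n = m, so the equations before index m
    merely double.\<close>
  have unroll: "2 ^ Suc m dvd v 0 (Suc m) - 2 ^ n * v n (Suc m)" if "n \<le> m" for n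
    using that
  proof (induction n)
    case (Suc n)
    have "2 ^ Suc m dvd 2 ^ n * (v n (Suc m) - 2 * v (Suc n) (Suc m))"
      using step[of "Suc m" n] Suc.prems by (simp add: dvd_mult)
    then have "2 ^ Suc m dvd (v 0 (Suc m) - 2 ^ n * v n (Suc m)) + 2 ^ n * (v n (Suc m) - 2 * v (Suc n) (Suc m))"
      using Suc by (intro dvd_add) auto
    then show ?case by (simp add: algebra_simps)
  qed simp
  have "even (v m (Suc m))"
    using unroll[of m] by (simp add: z mult.commute)
  \<comment> \<open>The equation at index m adds 1 to an even number, modulo a power of 2.\<close>
  moreover have "odd (v m (Suc m))"
    using dvd_trans[OF _ step[of "Suc m" m], of 2] by simp
  ultimately show False by simp
qed

section \<open>Coding the quotients in the type \<open>nat \<Rightarrow> int\<close>\<close>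

definition encode :: "(nat \<times> nat \<Rightarrow>\<^sub>0 int) \<Rightarrow> nat \<Rightarrow> int"
  where "encode x = (\<lambda>n. lookup x (prod_decode n))"

definition decode :: "(nat \<Rightarrow> int) \<Rightarrow> nat \<times> nat \<Rightarrow>\<^sub>0 int"
  where "decode = inv_into UNIV encode"

lemma decode_encode: "decode (encode x) = x"
proof -
  have "inj encode"
  proof (rule injI)
    fix x y assume "encode x = encode y"
    then have "lookup x q = lookup y q" for q
      by (metis encode_def prod_encode_inverse)
    then show "x = y" by (rule poly_mapping_eqI)
  qed
  then show ?thesis by (simp add: decode_def)
qed

text \<open>Cosets are coded by chosen representatives, to keep the groups in the type \<^typ>\<open>nat \<Rightarrow> int\<close>.\<close>

definition residue :: "nat \<Rightarrow> (nat \<times> nat \<Rightarrow>\<^sub>0 int) \<Rightarrow> nat \<Rightarrow> int"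
  where "residue i x = encode (SOME y. y - x \<in> relators i)"

lemma decode_residue: "decode (residue i x) - x \<in> relators i"
  unfolding residue_def decode_encode by (rule someI[of _ x]) (simp add: zero_in_relators)

lemma residue_eq_iff: "residue i x = residue i y \<longleftrightarrow> x - y \<in> relators i"
proof
  assume "residue i x = residue i y"
  then have "(decode (residue i y) - y) - (decode (residue i x) - x) = x - y" by simp
  then show "x - y \<in> relators i"
    using diff_in_relators[OF decode_residue[of i y] decode_residue[of i x]] by simp
next
  assume xy: "x - y \<in> relators i"
  \<comment> \<open>Equal predicates make \<open>SOME\<close> pick the same representative for the
    whole coset.\<close>
  have "z - x \<in> relators i \<longleftrightarrow> z - y \<in> relators i" for z
    using add_in_relators[OF _ xy, of "z - x"] diff_in_relators[OF _ xy, of "z - y"] by auto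
  then show "residue i x = residue i y" by (simp add: residue_def)
qed

definition quotient_tower :: "nat \<Rightarrow> (nat \<Rightarrow> int) monoid"
  where "quotient_tower i = \<lparr>carrier = range (residue i),
    monoid.mult = (\<lambda>a b. residue i (decode a + decode b)), one = residue i 0\<rparr>"

definition quotient_map :: "nat \<Rightarrow> (nat \<Rightarrow> int) \<Rightarrow> nat \<Rightarrow> int"
  where "quotient_map i a = residue i (decode a)"

lemma carrier_quotient_tower: "carrier (quotient_tower i) = range (residue i)"
  and one_quotient_tower: "\<one>\<^bsub>quotient_tower i\<^esub> = residue i 0"
  and mult_quotient_tower: "a \<otimes>\<^bsub>quotient_tower i\<^esub> b = residue i (decode a + decode b)"
  by (simp_all add: quotient_tower_def)

lemma residue_decode: "a \<in> carrier (quotient_tower i) \<Longrightarrow> residue i (decode a) = a"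
  using decode_residue by (auto simp: carrier_quotient_tower residue_eq_iff)

lemma mult_residue: "residue i x \<otimes>\<^bsub>quotient_tower i\<^esub> residue i y = residue i (x + y)"
  using add_in_relators[OF decode_residue[of i x] decode_residue[of i y]]
  by (simp add: mult_quotient_tower residue_eq_iff algebra_simps)

lemma comm_group_quotient_tower: "comm_group (quotient_tower i)"
proof (rule comm_groupI)
  fix a assume "a \<in> carrier (quotient_tower i)"
  then obtain x where "a = residue i x" by (auto simp: carrier_quotient_tower)
  then have "residue i (- x) \<otimes>\<^bsub>quotient_tower i\<^esub> a = \<one>\<^bsub>quotient_tower i\<^esub>"
    by (simp add: mult_residue one_quotient_tower)
  then show "\<exists>b \<in> carrier (quotient_tower i). b \<otimes>\<^bsub>quotient_tower i\<^esub> a = \<one>\<^bsub>quotient_tower i\<^esub>"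
    by (auto simp: carrier_quotient_tower)
qed (auto simp: carrier_quotient_tower mult_residue one_quotient_tower add_ac)

lemma pow_residue: "residue i x [^]\<^bsub>quotient_tower i\<^esub> m = residue i (frag_cmul (int m) x)" for m :: nat
proof -
  interpret comm_group "quotient_tower i" by (rule comm_group_quotient_tower)
  show ?thesis
    by (induction m) (simp_all add: one_quotient_tower mult_residue frag_cmul_distrib add.commute)
qed

lemma quotient_map_residue: "quotient_map i (residue (Suc i) x) = residue i x"
  using decode_residue[of "Suc i" x] relators_antimono[of i "Suc i"]
  by (auto simp: quotient_map_def residue_eq_iff)

lemma quotient_map_epi: "quotient_map i \<in> epi (quotient_tower (Suc i)) (quotient_tower i)"
  by (auto simp: epi_def hom_def carrier_quotient_tower mult_residue quotient_map_residue image_image)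

lemma abelian_tower_quotient_tower: "abelian_tower quotient_tower quotient_map"
  using comm_group_quotient_tower quotient_map_epi by (simp add: abelian_tower_def epi_def)

abbreviation quotient_lim :: "(nat \<Rightarrow> nat \<Rightarrow> int) monoid"
  where "quotient_lim \<equiv> tower_lim quotient_tower quotient_map"

lemma carrier_quotient_lim:
  "x \<in> carrier quotient_lim \<longleftrightarrow>
    (\<forall>i. x i \<in> carrier (quotient_tower i) \<and> quotient_map i (x (Suc i)) = x i)"
  by (auto simp: tower_lim_def)

lemma mult_quotient_lim:
  "(x \<otimes>\<^bsub>quotient_lim\<^esub> y) i = residue i (decode (x i) + decode (y i))"
  by (simp add: tower_lim_def mult_quotient_tower)

lemma residue_in_quotient_lim: "(\<lambda>i. residue i x) \<in> carrier quotient_lim"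
  by (simp add: carrier_quotient_lim carrier_quotient_tower quotient_map_residue)

text \<open>Telescoping: consecutive representatives from level i + d on agree modulo
  \<open>relators (i + d)\<close>, which lies in \<open>relators i\<close>.\<close>

lemma decode_coherent:
  assumes "x \<in> carrier quotient_lim"
  shows "decode (x (i + d)) - decode (x i) \<in> relators i"
proof (induction d)
  case (Suc d)
  have "residue (i + d) (decode (x (Suc (i + d)))) = residue (i + d) (decode (x (i + d)))"
    using assms by (simp add: carrier_quotient_lim quotient_map_def residue_decode)
  then have "decode (x (Suc (i + d))) - decode (x (i + d)) \<in> relators i"
    using relators_antimono[of i "i + d"] by (auto simp: residue_eq_iff)
  from add_in_relators[OF this Suc] show ?case by simp
qed (simp add: zero_in_relators)

section \<open>A bilinear cocycle on the limit\<close>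

definition scale :: "('a \<Rightarrow> int) \<Rightarrow> ('a \<Rightarrow>\<^sub>0 int) \<Rightarrow> ('a \<Rightarrow>\<^sub>0 int)"
  where "scale w x = Poly_Mapping.mapp (\<lambda>q c. w q * c) x"

lemma lookup_scale: "lookup (scale w x) q = w q * lookup x q"
  by (auto simp: scale_def lookup_mapp when_def in_keys_iff)

lemma scale_diff_right: "scale w (x - y) = scale w x - scale w y"
  by (rule poly_mapping_eqI) (simp add: lookup_scale lookup_minus algebra_simps)

lemma scale_diff_left: "scale (\<lambda>q. w q - w' q) x = scale w x - scale w' x"
  by (rule poly_mapping_eqI) (simp add: lookup_scale lookup_minus algebra_simps)

lemma scale_one: "scale (\<lambda>q. 1) x = x"
  by (rule poly_mapping_eqI) (simp add: lookup_scale)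

text \<open>Split w(j,k) as (w(j,k) - w(j,0)) + w(j,0). The first part adds multiples of 2^j to the
  row sum, the second multiplies it by w(j,0). So weights constant modulo 2^j along row j act on the
  quotient.\<close>

lemma scale_relator:
  assumes r: "r \<in> relators 0" and w: "\<And>j k. 2 ^ j dvd w (j, k) - w (j, 0)"
  shows "scale w r \<in> relators 0"
proof -
  have r': "2 ^ k dvd lookup r (j, k)" for j k using r by (simp add: relators_def)
  have "2 ^ j dvd row_sum j (scale w r)" for j
  proof -
    let ?d = "\<lambda>k. lookup r (j, k) div 2 ^ k"
    have f: "finite {k. c k * ?d k \<noteq> 0}" for c :: "nat \<Rightarrow> int"
      by (rule finite_subset[OF _ finite_row_div[of r j]]) auto
    have "row_sum j (scale w r) = Sum_any (\<lambda>k. (w (j, k) - w (j, 0)) * ?d k + w (j, 0) * ?d k)"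
      unfolding row_sum_def
      by (rule Sum_any.cong) (auto simp: lookup_scale div_mult_swap r' algebra_simps)
    also have "\<dots> = Sum_any (\<lambda>k. (w (j, k) - w (j, 0)) * ?d k) + Sum_any (\<lambda>k. w (j, 0) * ?d k)"
      by (rule Sum_any.distrib[OF f f])
    also have "Sum_any (\<lambda>k. w (j, 0) * ?d k) = w (j, 0) * row_sum j r"
      unfolding row_sum_def by (rule Sum_any_right_distrib[symmetric, OF finite_row_div])
    finally show ?thesis
      using w r by (auto simp: relators_def intro!: dvd_add dvd_Sum_any)
  qed
  then show ?thesis using r' by (auto simp: relators_def lookup_scale)
qed

text \<open>In the quotient 2^{j+k} e_{j,k} = 2^j e_{j,0} = 0, so a weight matters only modulo
  2^{j+k}.\<close>

lemma scale_small:
  assumes "\<And>j k. 2 ^ (j + k) dvd w (j, k)"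
  shows "scale w x \<in> relators 0"
proof -
  have "2 ^ k dvd lookup (scale w x) (j, k)" for j k
    using dvd_trans[OF le_imp_power_dvd[of k "j + k" 2] assms[of j k]] by (simp add: lookup_scale)
  moreover have "2 ^ j dvd lookup (scale w x) (j, k) div 2 ^ k" for j k
  proof -
    obtain t where "w (j, k) = 2 ^ (j + k) * t" using assms by blast
    then have "lookup (scale w x) (j, k) = (2 ^ j * (t * lookup x (j, k))) * 2 ^ k"
      by (simp add: lookup_scale power_add)
    then show ?thesis by simp
  qed
  ultimately show ?thesis by (auto simp: relators_def row_sum_def intro: dvd_Sum_any)
qed

text \<open>
  Multiplication of row entries by the 2-adic integer in position $(0,0)$: the generator $e_{j,k}$
  is annihilated by $2^{j+k}$ modulo \<open>relators 0\<close>, so level $j + k$ of the limit suffices.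
\<close>

definition weight :: "(nat \<Rightarrow> nat \<Rightarrow> int) \<Rightarrow> nat \<times> nat \<Rightarrow> int"
  where "weight x q = lookup (decode (x (fst q + snd q))) (0, 0)"

definition pairing :: "(nat \<Rightarrow> nat \<Rightarrow> int) \<Rightarrow> (nat \<Rightarrow> nat \<Rightarrow> int) \<Rightarrow> nat \<times> nat \<Rightarrow>\<^sub>0 int"
  where "pairing x y = scale (weight x) (decode (y 0))"

text \<open>Levels j + k and j of x agree modulo \<open>relators j\<close>, whose (0, 0) entries are
  multiples of 2^j. This supplies the hypothesis of \<open>scale_relator\<close>.\<close>

lemma weight_coherent:
  assumes "x \<in> carrier quotient_lim"
  shows "2 ^ j dvd weight x (j, k) - weight x (j, 0)"
  using decode_coherent[OF assms, of j k] by (simp add: weight_def relators_def lookup_minus)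

lemma weight_residue: "2 ^ (j + k) dvd weight (\<lambda>i. residue i x) (j, k) - lookup x (0, 0)"
  using decode_residue[of "j + k" x] by (simp add: weight_def relators_def lookup_minus)

lemma weight_mult: "2 ^ (j + k) dvd weight (x \<otimes>\<^bsub>quotient_lim\<^esub> y) (j, k) - weight x (j, k) - weight y (j, k)"
  using decode_residue[of "j + k" "decode (x (j + k)) + decode (y (j + k))"]
  by (simp add: weight_def mult_quotient_lim relators_def lookup_minus lookup_add algebra_simps)

text \<open>The defect on the left is an error in the weights, handled by
  \<open>scale_small\<close>; the one on the right is a relator being scaled, handled by
  \<open>scale_relator\<close>.\<close>

lemma pairing_mult_left:
  "pairing (x \<otimes>\<^bsub>quotient_lim\<^esub> x') y - pairing x y - pairing x' y \<in> relators 0"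
  unfolding pairing_def scale_diff_left[symmetric] by (rule scale_small) (rule weight_mult)

lemma pairing_mult_right:
  assumes "x \<in> carrier quotient_lim"
  shows "pairing x (y \<otimes>\<^bsub>quotient_lim\<^esub> y') - pairing x y - pairing x y' \<in> relators 0"
  unfolding pairing_def scale_diff_right[symmetric]
  by (rule scale_relator)
    (use decode_residue[of 0 "decode (y 0) + decode (y' 0)"] weight_coherent[OF assms] in
      \<open>simp_all add: mult_quotient_lim algebra_simps\<close>)

section \<open>The map induced on H_2 of the limit\<close>

definition pairing_chain :: "((nat \<Rightarrow> nat \<Rightarrow> int) list \<Rightarrow>\<^sub>0 int) \<Rightarrow> nat \<times> nat \<Rightarrow>\<^sub>0 int"
  where "pairing_chain = frag_extend (\<lambda>xs. pairing (xs ! 0) (xs ! 1))"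

text \<open>Bilinear maps are 2-cocycles: on a generating boundary the value is the additivity
  defect in the second argument minus that in the first.\<close>

lemma pairing_chain_boundary:
  assumes "c \<in> bar_boundaries 2 quotient_lim"
  shows "pairing_chain c \<in> relators 0"
  using assms
proof (induction c rule: bar_boundaries_2_induct)
  case (boundary x y z)
  let ?m = "\<lambda>x y. x \<otimes>\<^bsub>quotient_lim\<^esub> y"
  have "pairing_chain (frag_of [y, z] - frag_of [?m x y, z] + frag_of [x, ?m y z] - frag_of [x, y])
    = (pairing x (?m y z) - pairing x y - pairing x z) - (pairing (?m x y) z - pairing x z - pairing y z)"
    by (simp add: pairing_chain_def frag_extend_add frag_extend_diff)
  then show ?case
    by (simp only: diff_in_relators pairing_mult_right[OF boundary(1)] pairing_mult_left)
qed (simp_all add: pairing_chain_def frag_extend_diff diff_in_relators zero_in_relators)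

lemma pairing_residue_basis:
  "pairing (\<lambda>i. residue i (frag_of (0, 0))) (\<lambda>i. residue i x) - x \<in> relators 0"
proof -
  let ?w = "weight (\<lambda>i. residue i (frag_of (0, 0)))"
  \<comment> \<open>The difference consists of a change of representative and of the error of the
    weights, which are congruent to 1 because b is the unit of the 2-adic integers.\<close>
  have "scale ?w (decode (residue 0 x) - x) + scale (\<lambda>q. ?w q - 1) x \<in> relators 0"
    using weight_residue[of _ _ "frag_of (0, 0)"]
    by (intro add_in_relators scale_relator scale_small decode_residue weight_coherent residue_in_quotient_lim) simp
  then show ?thesis
    by (simp add: pairing_def scale_diff_right scale_diff_left scale_one)
qed

text \<open>All weights are then divisible by 2^{j+k}. This removes the swapped half [c_n|b] of <b,
  c_n>.\<close>

lemma pairing_residue_zero: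
  assumes "lookup x (0, 0) = 0"
  shows "pairing (\<lambda>i. residue i x) y \<in> relators 0"
  unfolding pairing_def
  by (rule scale_small) (use weight_residue[of _ _ x] assms in simp)

theorem theorem1:
  shows "\<exists>(A :: nat \<Rightarrow> (nat \<Rightarrow> int) monoid) f.
    abelian_tower A f \<and>
    (\<forall>i. f i \<in> epi (A (Suc i)) (A i)) \<and>
    \<not> cotorsion_group
      ((group_homology 2 (tower_lim A f))\<lparr>carrier :=
        kernel (group_homology 2 (tower_lim A f))
               (tower_lim (\<lambda>i. group_homology 2 (A i)) (\<lambda>i. group_homology_map 2 (A i) (f i)))
               (homology_lim_map 2 A)\<rparr>)"
proof (intro exI conjI allI notI)
  show "abelian_tower quotient_tower quotient_map" by (rule abelian_tower_quotient_tower)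
  show "quotient_map i \<in> epi (quotient_tower (Suc i)) (quotient_tower i)" for i
    by (rule quotient_map_epi)
  let ?L = quotient_lim
  let ?B = "bar_boundaries 2 ?L"
  define Z where "Z = {c \<in> bar_cycles 2 ?L.
    \<forall>i. frag_extend (frag_of \<circ> map (\<lambda>x. x i)) c \<in> bar_boundaries 2 (quotient_tower i)}"
  define cl where "cl c = (\<lambda>b. b + c) ` ?B" for c
  define K where "K = (group_homology 2 ?L)\<lparr>carrier :=
        kernel (group_homology 2 ?L)
               (tower_lim (\<lambda>i. group_homology 2 (quotient_tower i))
                 (\<lambda>i. group_homology_map 2 (quotient_tower i) (quotient_map i)))
               (homology_lim_map 2 quotient_tower)\<rparr>"
  have carrier_K: "carrier K = cl ` Z"
    unfolding K_def cl_def Z_def using kernel_homology_lim_map[of quotient_tower quotient_map] by simp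
  have mult: "cl c \<otimes>\<^bsub>K\<^esub> cl d = cl (c + d)" for c d
    using mult_group_homology[where n = 2 and G = ?L and c = c and d = d] by (simp add: K_def cl_def)
  have Zadd: "c + d \<in> Z" if "c \<in> Z" "d \<in> Z" for c d
    using that by (simp add: Z_def add_in_bar_cycles frag_extend_add add_in_bar_boundaries)
  assume "cotorsion_group
      ((group_homology 2 ?L)\<lparr>carrier :=
        kernel (group_homology 2 ?L)
               (tower_lim (\<lambda>i. group_homology 2 (quotient_tower i))
                 (\<lambda>i. group_homology_map 2 (quotient_tower i) (quotient_map i)))
               (homology_lim_map 2 quotient_tower)\<rparr>)"
  then have cot: "cotorsion_group K" by (simp only: K_def)
  \<comment> \<open>\<open>e 0\<close> is b and \<open>e n\<close> for n > 0 is c_n, both as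
    constant threads; \<open>\<kappa> n\<close> is then <b, c_{n+1}>.\<close>
  define e where "e n = (\<lambda>i. residue i (frag_of (n, 0)))" for n :: nat
  define \<kappa> where "\<kappa> n = commutator_chain (e 0) (e (Suc n))" for n
  have eL: "e n \<in> carrier ?L" for n unfolding e_def by (rule residue_in_quotient_lim)
  have \<kappa>Z: "\<kappa> n \<in> Z" for n
  proof -
    have "commutator_chain (e 0 i) (e (Suc n) i) \<in> bar_boundaries 2 (quotient_tower i)" for i
    proof -
      \<comment> \<open>At level i, b is killed by \<open>2 ^ i\<close> and c_{n+1} is a
        \<open>2 ^ i\<close>-th power, so their product bounds.\<close>
      have "residue i (frag_of (0, 0)) [^]\<^bsub>quotient_tower i\<^esub> (2 ^ i :: nat) = \<one>\<^bsub>quotient_tower i\<^esub>"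
        using relator_0[of i] by (simp add: pow_residue one_quotient_tower residue_eq_iff)
      moreover have "residue i (frag_of (Suc n, 0)) = residue i (frag_of (Suc n, i)) [^]\<^bsub>quotient_tower i\<^esub> (2 ^ i :: nat)"
        using relator_power[of "Suc n" i] by (simp add: pow_residue residue_eq_iff)
      ultimately show ?thesis
        using commutator_chain_annihilated[OF comm_group_quotient_tower]
        by (simp add: e_def carrier_quotient_tower)
    qed
    moreover have "e 0 \<otimes>\<^bsub>?L\<^esub> e (Suc n) = e (Suc n) \<otimes>\<^bsub>?L\<^esub> e 0"
      by (simp add: fun_eq_iff mult_quotient_lim add.commute)
    ultimately show ?thesis
      unfolding Z_def \<kappa>_def by (simp add: commutator_chain_in_bar_cycles eL frag_extend_commutator_chain)
  qed
  have closed: "u \<otimes>\<^bsub>K\<^esub> v \<in> carrier K" if uv: "u \<in> carrier K" "v \<in> carrier K" for u v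
  proof -
    obtain c d where "u = cl c" "v = cl d" "c \<in> Z" "d \<in> Z" using uv unfolding carrier_K by blast
    then show ?thesis unfolding carrier_K by (simp only: mult imageI Zadd)
  qed
  have \<kappa>K: "cl (\<kappa> n) \<in> carrier K" for n
    unfolding carrier_K using \<kappa>Z by blast
  obtain x where x: "\<And>n. x n \<in> carrier K"
    and step: "\<And>n. x n = x (Suc n) \<otimes>\<^bsub>K\<^esub> x (Suc n) \<otimes>\<^bsub>K\<^esub> cl (\<kappa> n)"
    using cotorsion_group_solution[where k = "\<lambda>n. cl (\<kappa> n)", OF cot closed \<kappa>K] by metis
  have "\<forall>n. \<exists>z. x n = cl z" using x unfolding carrier_K by blast
  then obtain z where z: "\<And>n. x n = cl (z n)" by metis
  \<comment> \<open>The equations between classes hold for the chains \<open>z n\<close> up to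
    boundaries, which \<open>pairing_chain\<close> sends into \<open>relators 0\<close>. Its values
    u_n thus solve u_n = 2 u_{n+1} + c_{n+1} modulo \<open>relators 0\<close>.\<close>
  have "pairing_chain (z n) - (pairing_chain (z (Suc n)) + pairing_chain (z (Suc n)) + frag_of (Suc n, 0))
      \<in> relators 0" for n
  proof -
    have "cl (z n) = cl (z (Suc n) + z (Suc n) + \<kappa> n)"
      using step[of n] by (simp only: z mult)
    then have "pairing_chain (z n - (z (Suc n) + z (Suc n) + \<kappa> n)) \<in> relators 0"
      unfolding cl_def bar_coset_eq_iff by (rule pairing_chain_boundary)
    moreover have "pairing_chain (\<kappa> n) - frag_of (Suc n, 0) \<in> relators 0"
    proof -
      have "pairing_chain (\<kappa> n) - frag_of (Suc n, 0) =
          (pairing (e 0) (e (Suc n)) - frag_of (Suc n, 0)) - pairing (e (Suc n)) (e 0)"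
        by (simp add: \<kappa>_def commutator_chain_def pairing_chain_def frag_extend_diff)
      moreover have "pairing (e (Suc n)) (e 0) \<in> relators 0"
        unfolding e_def by (rule pairing_residue_zero) (simp add: lookup_single)
      moreover have "pairing (e 0) (e (Suc n)) - frag_of (Suc n, 0) \<in> relators 0"
        unfolding e_def by (rule pairing_residue_basis)
      ultimately show ?thesis by (simp only: diff_in_relators)
    qed
    ultimately have "pairing_chain (z n - (z (Suc n) + z (Suc n) + \<kappa> n))
        + (pairing_chain (\<kappa> n) - frag_of (Suc n, 0)) \<in> relators 0"
      by (rule add_in_relators)
    moreover have "pairing_chain (z n - (z (Suc n) + z (Suc n) + \<kappa> n))
        + (pairing_chain (\<kappa> n) - frag_of (Suc n, 0)) =
        pairing_chain (z n) - (pairing_chain (z (Suc n)) + pairing_chain (z (Suc n)) + frag_of (Suc n, 0))"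
      by (simp add: pairing_chain_def frag_extend_add frag_extend_diff)
    ultimately show ?thesis by (simp only:)
  qed
  then show False by (rule no_divisible_sequence_mod_relators)
qed

end
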